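(* Let $n\ge3$. The number of permutations in $S_n$ equivalent to the identity $\iota_n=12\cdots n$ under adjacent $\{\{123,132,321\}\}$-equivalence is $$\begin{cases}\frac32\,k(k+1)(2k-1)! & \text{if } n=2k+1 \text{ is odd},\\[2pt] \frac32\,k\left(k-\frac13\right)(2k-2)!-(2k-3)!! & \text{if } n=2k \text{ is even},\end{cases}$$ where for odd positive $m$, $m!!=1\cdot3\cdot5\cdots m$.
   Context: Permutations are written as words $\pi_1\cdots\pi_n$. A sequence of distinct integers $a_1a_2a_3$ has pattern $\sigma\in S_3$ if $a_s<a_t\iff\sigma_s<\sigma_t$. An adjacent move on $\pi\in S_n$ chooses three consecutive positions $i,i+1,i+2$ with $\pi_i\pi_{i+1}\pi_{i+2}$ of pattern $\sigma\in\{123,132,321\}$ and rearranges these three values in these positions to have a pattern $\sigma'\in\{123,132,321\}$. Equivalence is the equivalence relation generated by such moves. *)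

theory Defs
  imports Complex_Main "HOL-Combinatorics.Multiset_Permutations"
begin

definition has_pattern :: "nat list \<Rightarrow> nat list \<Rightarrow> bool" where
  "has_pattern a \<sigma> \<longleftrightarrow> length a = length \<sigma> \<and>
     (\<forall>s < length a. \<forall>t < length a. a ! s < a ! t \<longleftrightarrow> \<sigma> ! s < \<sigma> ! t)"

text \<open>
  A permutation in \<open>S\<^sub>n\<close> is represented by its word, an element of
  \<^term>\<open>permutations_of_set {1..n}\<close>. Since a word of \<open>S\<^sub>n\<close> has distinct letters,
  \<^term>\<open>mset b = mset a\<close> says that \<open>b\<close> is a rearrangement of the factor \<open>a\<close>.
\<close>

definition adjacent_move :: "nat \<Rightarrow> nat list set \<Rightarrow> nat list \<Rightarrow> nat list \<Rightarrow> bool" where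
  "adjacent_move n B p q \<longleftrightarrow> p \<in> permutations_of_set {1..n} \<and>
     (\<exists>u a b v \<sigma> \<sigma>'. p = u @ a @ v \<and> q = u @ b @ v \<and> length a = 3 \<and> mset b = mset a \<and>
        \<sigma> \<in> B \<and> \<sigma>' \<in> B \<and> has_pattern a \<sigma> \<and> has_pattern b \<sigma>')"

definition adjacent_equiv :: "nat \<Rightarrow> nat list set \<Rightarrow> nat list \<Rightarrow> nat list \<Rightarrow> bool" where
  "adjacent_equiv n B = equivclp (adjacent_move n B)"

definition iota_word :: "nat \<Rightarrow> nat list" where
  "iota_word n = [1..<n + 1]"

definition odd_double_fact :: "nat \<Rightarrow> nat" where
  "odd_double_fact m = \<Prod>{i \<in> {1..m}. odd i}"

end

theory Submission
  imports Defs
begin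

text \<open>
  In every allowed triple the minimum comes first or last, so a move shifts 1 by two positions or not
  at all, and 2 likewise unless 1 is in the same triple. Hence, counting positions from 1, ``1 is at an
  odd position, and 2 is at an even position or to the right of 1'' is invariant.
  Conversely, once 1 is at the front, it can travel to the right in steps of two and sort what it
  passes, so all words starting with 1 are equivalent; and 1 can be brought to the front from
  every word satisfying the invariant, except for words ending in 12 in which no triple has an
  allowed pattern. Read from the right, these exceptions are lists of pairs
  (larger, smaller) with increasing smaller entries, that is, perfect matchings, one of which pairs
  1 with 2; there are \<open>(n - 3)!!\<close> of them for even \<open>n\<close>.
\<close>

section \<open>Moves on arbitrary words and the equivalence that they generate\<close>

definition allowed_orders :: "nat \<Rightarrow> nat \<Rightarrow> nat \<Rightarrow> nat list set" where
  "allowed_orders a b c = {[a, b, c], [a, c, b], [c, b, a]}"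

text \<open>Moves are defined on arbitrary words instead of on S_n, so that they can be carried out
  inside a factor. Since \<open>step\<close> is symmetric, its reflexive transitive closure is
  already the generated equivalence.\<close>

definition step :: "nat list \<Rightarrow> nat list \<Rightarrow> bool" where
  "step p q \<longleftrightarrow> (\<exists>u v a b c s t. a < b \<and> b < c \<and> s \<in> allowed_orders a b c \<and> t \<in> allowed_orders a b c \<and>
     p = u @ s @ v \<and> q = u @ t @ v)"

abbreviation eqv :: "nat list \<Rightarrow> nat list \<Rightarrow> bool" (infix "\<approx>" 50) where
  "p \<approx> q \<equiv> step\<^sup>*\<^sup>* p q"

lemma step_sym: "step p q \<Longrightarrow> step q p"
  unfolding step_def by metis

lemma eqv_sym: "p \<approx> q \<Longrightarrow> q \<approx> p"
  by (rule sympD[OF symp_rtranclp]) (auto intro: sympI step_sym)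

lemma step_context: "step p q \<Longrightarrow> step (u @ p @ v) (u @ q @ v)"
  unfolding step_def by (metis append.assoc)

lemma eqv_context: "p \<approx> q \<Longrightarrow> u @ p @ v \<approx> u @ q @ v"
  by (induction rule: rtranclp_induct) (auto intro: step_context rtranclp.rtrancl_into_rtrancl)

lemma eqv_left: "p \<approx> q \<Longrightarrow> u @ p \<approx> u @ q"
  using eqv_context[of p q u "[]"] by simp

lemma eqv_right: "p \<approx> q \<Longrightarrow> p @ v \<approx> q @ v"
  using eqv_context[of p q "[]" v] by simp

lemma step_mset: "step p q \<Longrightarrow> mset q = mset p"
  unfolding step_def allowed_orders_def by auto

lemma eqv_mset: "p \<approx> q \<Longrightarrow> mset q = mset p"
  by (induction rule: rtranclp_induct) (auto dest: step_mset)

lemma eqv_length: "p \<approx> q \<Longrightarrow> length q = length p"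
  by (metis eqv_mset size_mset)

lemma eqv_set: "p \<approx> q \<Longrightarrow> set q = set p"
  by (metis eqv_mset set_mset_mset)

lemma eqv_distinct: "p \<approx> q \<Longrightarrow> distinct q = distinct p"
  by (metis eqv_mset mset_eq_imp_distinct_iff)

lemma eqv_allowed_orders:
  assumes "a < b" "b < c" "s \<in> allowed_orders a b c" "t \<in> allowed_orders a b c"
  shows "u @ s @ v \<approx> u @ t @ v"
  using assms unfolding step_def by (intro r_into_rtranclp) blast

lemma eqv_123_132: "a < b \<Longrightarrow> b < c \<Longrightarrow> u @ [a, b, c] @ v \<approx> u @ [a, c, b] @ v"
  by (rule eqv_allowed_orders[of a b c]) (auto simp: allowed_orders_def)

section \<open>Sorting the letters to the right of a minimum\<close>

lemma eqv_swap_after_min: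
  assumes "m < x" "m < y"
  shows "u @ [m, x, y] @ v \<approx> u @ [m, y, x] @ v"
proof (cases "x = y")
  case False
  then have "x < y \<or> y < x" by auto
  then show ?thesis using assms eqv_123_132 eqv_sym by meson
qed simp

lemma eqv_min_right:
  assumes "m < x" "x < y"
  shows "u @ [m, x, y] @ v \<approx> u @ [y, x, m] @ v"
  by (rule eqv_allowed_orders[OF assms]) (auto simp: allowed_orders_def)

lemma eqv_min_right_132:
  assumes "m < x" "x < y"
  shows "u @ [m, y, x] @ v \<approx> u @ [y, x, m] @ v"
  by (rule eqv_allowed_orders[OF assms]) (auto simp: allowed_orders_def)

text \<open>Both 123 and 132 can be turned into 321. The letters \<open>c\<close> and
  \<open>d\<close> are chosen before the context, so one choice serves two words that differ only
  outside the triple.\<close>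

lemma eqv_min_right_ex:
  assumes "m < x" "m < y" "x \<noteq> y"
  shows "\<exists>c d. \<forall>u v. u @ [m, x, y] @ v \<approx> u @ [c, d, m] @ v"
  using assms eqv_min_right eqv_min_right_132 by (metis linorder_neqE_nat)

text \<open>For \<open>p < q < r\<close> the six orders of these letters behind \<open>m\<close>
  form a connected graph: \<open>sw\<close> exchanges the first two of them, which gives three
  disjoint edges, and the moves \<open>r1\<close> and \<open>r2\<close> on the last three positions
  join these edges.\<close>

lemma eqv_swap_next_after_min:
  assumes m: "m < a" "m < x" "m < y" and ne: "a \<noteq> x" "a \<noteq> y" "x \<noteq> y"
  shows "m # a # x # y # v \<approx> m # a # y # x # v"
proof -
  have sw: "m # p # q # r # v \<approx> m # q # p # r # v" if "m < p" "m < q" for p q r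
    using eqv_swap_after_min[OF that, of "[]" "r # v"] by simp
  have r1: "m # p # q # r # v \<approx> m # p # r # q # v" if "p < q" "q < r" for p q r
    using eqv_123_132[OF that, of "[m]" v] by simp
  have r2: "m # p # q # r # v \<approx> m # r # q # p # v" if "p < q" "q < r" for p q r
    using eqv_min_right[OF that, of "[m]" v] by simp
  have *: "m # p # q # r # v \<approx> m # p # r # q # v \<and> m # q # p # r # v \<approx> m # q # r # p # v
      \<and> m # r # p # q # v \<approx> m # r # q # p # v"
    if "m < p" "p < q" "q < r" for p q r
  proof -
    note s = sw[of p q r] sw[of p r q] sw[of q r p] r1[of p q r] r2[of p q r]
    note s' = s s[THEN eqv_sym]
    show ?thesis using s' that by (meson rtranclp_trans order.strict_trans)
  qed
  consider "a < x \<and> x < y" | "a < y \<and> y < x" | "x < a \<and> a < y" | "y < a \<and> a < x"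
    | "x < y \<and> y < a" | "y < x \<and> x < a" using ne by linarith
  then show ?thesis
    by cases (use * m eqv_sym in meson)+
qed

text \<open>The minimum jumps over two letters of \<open>u\<close> at a time until it is within one
  letter of \<open>x\<close> and \<open>y\<close>, the swap is made there, and the jumps are undone.
  Undoing is possible because the jumps turn \<open>a, b\<close> into the same \<open>c, d\<close>
  in both words.\<close>

lemma eqv_swap_right_of_min:
  assumes "distinct (u @ x # y # v)" "\<forall>z \<in> set (u @ x # y # v). m < z"
  shows "m # u @ x # y # v \<approx> m # u @ y # x # v"
  using assms
proof (induction u rule: induct_list012)
  case 1
  then show ?case using eqv_swap_after_min[of m x y "[]" v] by simp
next
  case (2 a)
  then show ?case using eqv_swap_next_after_min[of m a x y v] by auto
next
  case (3 a b u)
  then have "m < a" "m < b" "a \<noteq> b" by auto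
  from eqv_min_right_ex[OF this]
  obtain c d where cd: "\<And>u v. u @ [m, a, b] @ v \<approx> u @ [c, d, m] @ v" by blast
  have "m # u @ x # y # v \<approx> m # u @ y # x # v" using 3 by simp
  then have "[c, d] @ m # u @ x # y # v \<approx> [c, d] @ m # u @ y # x # v" by (rule eqv_left)
  then show ?case
    using cd[of "[]" "u @ x # y # v"] eqv_sym[OF cd[of "[]" "u @ y # x # v"]] by simp
qed

lemma eqv_pull_right_of_min:
  assumes "distinct (u @ w @ x # v)" "\<forall>z \<in> set (u @ w @ x # v). m < z"
  shows "m # u @ w @ x # v \<approx> m # u @ x # w @ v"
  using assms
proof (induction w arbitrary: v rule: rev_induct)
  case (snoc y w)
  have "m # (u @ w) @ y # x # v \<approx> m # (u @ w) @ x # y # v"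
    by (rule eqv_swap_right_of_min) (use snoc in auto)
  moreover have "m # u @ w @ x # y # v \<approx> m # u @ x # w @ y # v"
    by (rule snoc.IH) (use snoc in auto)
  ultimately show ?case by simp
qed simp

text \<open>Selection sort towards \<open>t\<close>: its next letter is pulled left to the end of
  the finished prefix \<open>u\<close>, which then grows by that letter.\<close>

lemma eqv_rearrange_right_of_min:
  assumes "mset s = mset t" "distinct (u @ s)" "\<forall>z \<in> set (u @ s). m < z"
  shows "m # u @ s \<approx> m # u @ t"
  using assms
proof (induction t arbitrary: u s)
  case (Cons x t)
  from Cons.prems(1) obtain w v where s: "s = w @ x # v"
    by (metis list.set_intros(1) mset_eq_setD split_list)
  have "m # u @ w @ x # v \<approx> m # u @ x # w @ v"
    by (rule eqv_pull_right_of_min) (use Cons.prems s in auto)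
  moreover have "m # (u @ [x]) @ (w @ v) \<approx> m # (u @ [x]) @ t"
    by (rule Cons.IH) (use Cons.prems s in auto)
  ultimately show ?case by (simp add: s)
qed simp

text \<open>Iterated jumps over two letters. This later carries 2 to the position just before 1 when
  it starts to the left of 1.\<close>

lemma eqv_move_min_right:
  assumes "even (length v)" "distinct v" "\<forall>z \<in> set v. m < z"
  shows "\<exists>v'. m # v \<approx> v' @ [m]"
  using assms
proof (induction v rule: induct_list012)
  case (3 a b v)
  then obtain v' where v': "m # v \<approx> v' @ [m]" by auto
  from 3 have "m < a" "m < b" "a \<noteq> b" by auto
  from eqv_min_right_ex[OF this]
  obtain c d where cd: "\<And>u v. u @ [m, a, b] @ v \<approx> u @ [c, d, m] @ v" by blast
  show ?case
    using cd[of "[]" v] eqv_left[OF v', of "[c, d]"]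
    by (intro exI[of _ "[c, d] @ v'"]) simp
qed (auto intro: exI[of _ "[]"])


section \<open>Words without moves, and descents at the end of all other words of even
  length\<close>

text \<open>The reversals of the words of even length that end in an ascent and admit no move.\<close>

fun matched :: "nat list \<Rightarrow> bool" where
  "matched [] \<longleftrightarrow> True"
| "matched [y] \<longleftrightarrow> False"
| "matched (y # x # r) \<longleftrightarrow> x < y \<and> (\<forall>z \<in> set r. x < z) \<and> matched r"

lemma matched_even: "matched r \<Longrightarrow> even (length r)"
  by (induction r rule: matched.induct) auto

text \<open>If the factor starts at the larger entry of a pair, then \<open>y\<close> is the smaller
  entry of that pair and lies below everything after it. Otherwise \<open>z\<close> is the smaller
  entry of a pair and \<open>y, x\<close> is the next pair. In the reversed word
  \<open>x y z\<close> thus has its minimum in the middle or has pattern 231, so it admits no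
  move.\<close>

lemma matched_factor:
  "matched (v @ z # y # x # u) \<Longrightarrow> (y < z \<and> y < x) \<or> (z < x \<and> x < y)"
proof (induction v rule: induct_list012)
  case (2 e)
  then show ?case by (cases u) auto
qed auto

lemma matched_no_step:
  assumes "matched r"
  shows "\<not> step (rev r) q"
proof
  assume "step (rev r) q"
  then obtain u v a b c s where *: "a < b" "b < c" "s \<in> allowed_orders a b c" "rev r = u @ s @ v"
    unfolding step_def by blast
  from *(3) obtain x y z where s: "s = [x, y, z]" unfolding allowed_orders_def by blast
  from *(4) have "r = rev (u @ s @ v)" by (metis rev_rev_ident)
  then have "r = rev v @ z # y # x # rev u" using s by simp
  with assms matched_factor have "(y < z \<and> y < x) \<or> (z < x \<and> x < y)" by metis
  with * s show False unfolding allowed_orders_def by auto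
qed

lemma matched_eqv_iff:
  assumes "matched r"
  shows "rev r \<approx> q \<longleftrightarrow> q = rev r"
  using assms matched_no_step by (metis converse_rtranclpE rtranclp.rtrancl_refl)

text \<open>A descent directly before 1 forms a 321 triple with it, which lets 1 move left.
  Induction on pairs from the right end reduces the claim to the last four letters
  \<open>a b x y\<close>: either the part before \<open>x y\<close> can be given a descent
  \<open>a b\<close>, or it is matched and the failure of \<open>matched\<close> comes from the new
  pair.\<close>

lemma eqv_ends_in_descent:
  assumes "even (length r)" "distinct r" "\<not> matched r"
  shows "\<exists>v x y. y < x \<and> rev r \<approx> v @ [x, y]"
  using assms
proof (induction r rule: induct_list012)
  case (3 y x r)
  show ?case
  proof (cases "y < x")
    case True
    then show ?thesis by auto
  next
    case False
    with 3 have xy: "x < y" by auto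
    have dr: "distinct (rev r @ [x, y])" using 3 by auto
    show ?thesis
    proof (cases "matched r")
      case False
      with 3 obtain v a b where ab: "b < a" "rev r \<approx> v @ [a, b]" by auto
      have e: "rev (y # x # r) \<approx> v @ [a, b, x, y]"
        using eqv_right[OF ab(2), of "[x, y]"] by simp
      have "distinct (v @ [a, b, x, y])"
        using eqv_distinct[OF e] 3 by auto
      then have d: "a \<noteq> b" "b \<noteq> x" "a \<noteq> x" "a \<noteq> y" "b \<noteq> y" by auto
      \<comment> \<open>If \<open>b < x\<close>, the triple \<open>b x y\<close> is increasing and
        is reversed. Otherwise \<open>a b x\<close> is decreasing and is rearranged with
        \<open>x\<close> in front; the order of \<open>a\<close> and \<open>b\<close> behind it is
        free and is chosen according to \<open>y\<close>.\<close>
      consider "b < x" | "x < b" "y < b" | "x < b" "b < y" "a < y" | "x < b" "b < y" "y < a"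
        using d by linarith
      then show ?thesis
      proof cases
        case 1
        have "v @ [a, b, x, y] \<approx> (v @ [a, y]) @ [x, b]"
          using eqv_min_right[OF 1 xy, of "v @ [a]" "[]"] by simp
        with e 1 show ?thesis by (meson rtranclp_trans)
      next
        case 2
        have "v @ [a, b, x, y] \<approx> (v @ [x, a]) @ [b, y]"
          using eqv_sym[OF eqv_min_right_132[of x b a v "[y]"]] 2 ab by simp
        with e 2 show ?thesis by (meson rtranclp_trans)
      next
        case 3
        have "v @ [a, b, x, y] \<approx> v @ [x, b, a, y]"
          using eqv_sym[OF eqv_min_right[of x b a v "[y]"]] 3 ab by simp
        moreover have "v @ [x, b, a, y] \<approx> (v @ [x, b]) @ [y, a]"
          using eqv_123_132[of b a y "v @ [x]" "[]"] 3 ab by simp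
        ultimately show ?thesis using e 3 by (meson rtranclp_trans)
      next
        case 4
        have "v @ [a, b, x, y] \<approx> (v @ [x, b]) @ [a, y]"
          using eqv_sym[OF eqv_min_right[of x b a v "[y]"]] 4 ab by simp
        with e 4 show ?thesis by (meson rtranclp_trans)
      qed
    next
      case True
      with 3 xy obtain z where "z \<in> set r" "\<not> x < z" by auto
      with True obtain b a r' where r: "r = b # a # r'" by (cases r rule: matched.cases) auto
      with True have a: "a < b" "\<forall>z \<in> set r'. a < z" by auto
      have d: "a \<noteq> x" "b \<noteq> x" "b \<noteq> y" using 3 r by auto
      \<comment> \<open>As \<open>r\<close> is matched, its second letter \<open>a\<close> is its
        minimum, so \<open>a\<close> is at most \<open>z\<close>, which is at most
        \<open>x\<close>.\<close>
      have ax: "a < x" using a \<open>z \<in> set r\<close> \<open>\<not> x < z\<close> r d by auto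
      define v where "v = rev r'"
      have p: "rev (y # x # r) = v @ [a, b, x, y]" by (simp add: r v_def)
      have sw: "v @ [a, b, x, y] \<approx> v @ [a, x, b, y]"
        using eqv_swap_after_min[OF a(1) ax, of v "[y]"] by simp
      consider "y < b" | "b < x" | "x < b" "b < y" using d by linarith
      then show ?thesis
      proof cases
        case 1
        then show ?thesis using sw p by (intro exI[of _ "v @ [a, x]"] exI[of _ b] exI[of _ y]) simp
      next
        case 2
        have "v @ [a, b, x, y] \<approx> (v @ [a, b]) @ [y, x]"
          using eqv_123_132[OF 2 xy, of "v @ [a]" "[]"] by simp
        then show ?thesis using xy p by metis
      next
        case 3
        have "v @ [a, x, b, y] \<approx> (v @ [a, x]) @ [y, b]"
          using eqv_123_132[OF 3, of "v @ [a]" "[]"] by simp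
        then show ?thesis using 3 p sw by (metis rtranclp_trans)
      qed
    qed
  qed
qed auto

section \<open>Bringing 1 to the front\<close>

text \<open>1 moves left by two positions at a time, with 2 and another letter kept on its right. A
  descent before 1 gives a 321 triple directly. An ascent \<open>x y\<close> before 1 gives the
  immovable pattern 231; there 2 is carried to the left of 1 to form the decreasing triple
  \<open>x 2 1\<close>, which becomes \<open>1 2 x\<close>.\<close>

lemma eqv_move_one_to_front:
  assumes "distinct (rev r @ 1 # s)" "0 \<notin> set (rev r @ 1 # s)" "even (length r)"
    "2 \<in> set s" "length s \<ge> 2"
  shows "\<exists>t. rev r @ 1 # s \<approx> 1 # t"
  using assms
proof (induction r arbitrary: s rule: induct_list012)
  case (3 y x r)
  have big: "z > 2" if "z \<in> set (x # y # r) \<or> z \<in> set s \<and> z \<noteq> 2" for z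
  proof -
    have "z \<noteq> 0" "z \<noteq> 1" "z \<noteq> 2" using 3 that by (auto intro: gr0I)
    then show ?thesis by linarith
  qed
  have shorten: ?case if *: "rev (y # x # r) @ 1 # s \<approx> rev r @ 1 # t" "2 \<in> set t" "length t \<ge> 2" for t
  proof -
    have "distinct (rev r @ 1 # t)" "0 \<notin> set (rev r @ 1 # t)"
      using eqv_distinct[OF *(1)] eqv_set[OF *(1)] 3 by blast+
    then have "\<exists>t'. rev r @ 1 # t \<approx> 1 # t'" using 3 * by auto
    with * show ?thesis by (meson rtranclp_trans)
  qed
  show ?case
  proof (cases "y < x")
    case True
    have "rev r @ [1, x, y] @ s \<approx> rev r @ [x, y, 1] @ s"
      using eqv_min_right_132[of 1 y x] big[of x] big[of y] True by auto
    then have "rev (y # x # r) @ 1 # s \<approx> rev r @ 1 # (x # y # s)"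
      using eqv_sym by simp
    then show ?thesis by (rule shorten) (use 3 in auto)
  next
    case False
    with 3 have xy: "x < y" by auto
    from 3 obtain s1 s2 where s12: "s = s1 @ 2 # s2" by (meson split_list)
    with 3 have "s1 @ s2 \<noteq> []" by auto
    \<comment> \<open>\<open>S\<close> is a helper letter: some letter other than 2 to the right of
      1. Sorting behind 1 puts \<open>S 2\<close> next to it, so that 1 can step back behind
      2.\<close>
    then obtain S s' where S: "s1 @ s2 = S # s'" by (meson neq_Nil_conv)
    have ms: "mset s = mset (S # 2 # s')"
    proof -
      have "mset s = add_mset 2 (mset (s1 @ s2))" by (simp add: s12)
      then show ?thesis by (simp add: S)
    qed
    then have Ss: "S \<in> set s" "set s = set (S # 2 # s')" by (metis list.set_intros(1) mset_eq_setD)+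
    have "distinct s" using 3 by auto
    then have "distinct (S # 2 # s')" using ms by (metis mset_eq_imp_distinct_iff)
    then have S2: "2 < S" using big[of S] Ss by auto
    have yS: "y \<noteq> S" using 3 Ss(1) by auto
    have x2: "2 < x" "2 < y" using big by auto
    have "1 # [] @ s \<approx> 1 # [] @ (S # 2 # s')"
    proof (rule eqv_rearrange_right_of_min[OF ms])
      show "\<forall>z \<in> set ([] @ s). 1 < z" using big 3 by fastforce
    qed (use 3 in auto)
    then have e1: "rev (y # x # r) @ 1 # s \<approx> rev r @ [x, y, 1, S, 2] @ s'"
      using eqv_left[of "1 # s" "1 # S # 2 # s'" "rev r @ [x, y]"] by simp
    have e2: "rev r @ [x, y, 1, S, 2] @ s' \<approx> rev r @ [x, y, S, 2, 1] @ s'"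
      using eqv_min_right_132[of 1 2 S "rev r @ [x, y]" s'] S2 by simp
    have e3: "rev r @ [x, 2, 1] @ v \<approx> rev r @ [1, 2, x] @ v" for v
      using eqv_sym[OF eqv_min_right[of 1 2 x "rev r" v]] x2 by simp
    \<comment> \<open>The letters \<open>y\<close> and \<open>S\<close> are put in decreasing order,
      so that first 2 and then 1 can jump left over both of them.\<close>
    have "\<exists>t. rev r @ [x, y, S, 2, 1] @ s' \<approx> rev r @ [x, 2, 1] @ t"
    proof (cases "S < y")
      case True
      have "rev r @ [x, y, S, 2, 1] @ s' \<approx> rev r @ [x, 2, y, S, 1] @ s'"
        using eqv_sym[OF eqv_min_right_132[of 2 S y "rev r @ [x]" "1 # s'"]] S2 x2 True by simp
      also have "rev r @ [x, 2, y, S, 1] @ s' \<approx> rev r @ [x, 2, 1] @ (y # S # s')"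
        using eqv_sym[OF eqv_min_right_132[of 1 S y "rev r @ [x, 2]" "s'"]] S2 x2 True by simp
      finally show ?thesis by blast
    next
      case False
      with yS have Sy: "y < S" by simp
      have "rev r @ [x, y, S, 2, 1] @ s' \<approx> rev r @ [x, S, y, 2, 1] @ s'"
        using eqv_123_132[OF xy Sy, of "rev r" "[2, 1] @ s'"] by simp
      also have "rev r @ [x, S, y, 2, 1] @ s' \<approx> rev r @ [x, 2, S, y, 1] @ s'"
        using eqv_sym[OF eqv_min_right_132[of 2 y S "rev r @ [x]" "1 # s'"]] S2 x2 Sy by simp
      also have "rev r @ [x, 2, S, y, 1] @ s' \<approx> rev r @ [x, 2, 1] @ (S # y # s')"
        using eqv_sym[OF eqv_min_right_132[of 1 y S "rev r @ [x, 2]" "s'"]] S2 x2 Sy by simp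
      finally show ?thesis by blast
    qed
    then obtain t where "rev r @ [x, y, S, 2, 1] @ s' \<approx> rev r @ [x, 2, 1] @ t" by blast
    with e1 e2 e3[of t] have "rev (y # x # r) @ 1 # s \<approx> rev r @ [1, 2, x] @ t"
      by (meson rtranclp_trans)
    then have "rev (y # x # r) @ 1 # s \<approx> rev r @ 1 # (2 # x # t)" by simp
    then show ?thesis by (rule shorten) auto
  qed
qed auto

section \<open>The invariant, and its sufficiency apart from the immovable words\<close>

text \<open>Positions are counted from 0 here.\<close>

definition parity_good :: "nat list \<Rightarrow> bool" where
  "parity_good p \<longleftrightarrow> (\<exists>i j. i < length p \<and> j < length p \<and> p ! i = 1 \<and> p ! j = 2 \<and> even i \<and> (odd j \<or> i < j))"

text \<open>A triple with minimum \<open>a\<close> keeps the parity of the positions of all letters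
  up to \<open>a\<close>. This settles 1 and 2 unless both lie in the triple, a case checked by
  listing the allowed orders.\<close>

lemma parity_good_step:
  assumes "parity_good p" "step p q" "0 \<notin> set p" "distinct p"
  shows "parity_good q"
proof -
  from assms(2) obtain u v a b c s t where st: "a < b" "b < c" "s \<in> allowed_orders a b c"
    "t \<in> allowed_orders a b c" "p = u @ s @ v" "q = u @ t @ v" unfolding step_def by blast
  have a0: "a \<noteq> 0" using st assms(3) by (auto simp: allowed_orders_def)
  from assms(1) obtain i j where ij: "i < length p" "j < length p" "p ! i = 1" "p ! j = 2" "even i"
    "odd j \<or> i < j" unfolding parity_good_def by blast
  define l where "l = length u"
  have len: "length s = 3" "length t = 3" using st by (auto simp: allowed_orders_def)
  have out: "q ! k = p ! k" if "k < l \<or> l + 3 \<le> k" for k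
    using that by (auto simp: st nth_append l_def len)
  have inn: "p ! (l + k) = s ! k" "q ! (l + k) = t ! k" if "k < 3" for k
    using that by (auto simp: st nth_append l_def len)
  note inn0 = inn[of 0] inn[of 1] inn[of 2]
  have lq: "length q = length p" "l + 3 \<le> length p" using st len by (auto simp: l_def)
  have pv: "k < l \<or> l + 3 \<le> k \<or> k = l \<or> k = l + 1 \<or> k = l + 2" for k by linarith
  \<comment> \<open>A letter not above \<open>a\<close> is either outside the triple and fixed, or
    is \<open>a\<close> itself, which sits at one of the two ends before and after the move.\<close>
  have move: "\<exists>k' < length p. q ! k' = x \<and> even k' = even k \<and> (k < l \<or> l + 3 \<le> k \<longrightarrow> k' = k) \<and>
      (l \<le> k \<and> k < l + 3 \<longrightarrow> x = a \<and> l \<le> k' \<and> k' < l + 3)"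
    if k: "k < length p" "p ! k = x" "x \<le> a" for k x
  proof (cases "k < l \<or> l + 3 \<le> k")
    case True
    then show ?thesis using out k by (intro exI[of _ k]) auto
  next
    case False
    then have "x = a" "k = l \<or> k = l + 2"
      using pv[of k] k inn0 st(1-3) by (auto simp: allowed_orders_def)
    moreover have "t ! 0 = a \<or> t ! 2 = a" using st(4) by (auto simp: allowed_orders_def)
    then have "q ! l = a \<or> q ! (l + 2) = a" using inn0 by simp
    then obtain k' where "q ! k' = a" "k' = l \<or> k' = l + 2" by blast
    ultimately show ?thesis using lq by (intro exI[of _ k']) auto
  qed
  show ?thesis
  \<comment> \<open>First case: 1 and 2 lie in the same triple. Then 1 is at one of its ends, so
    \<open>l\<close> is even, and 2 ends up at the odd position \<open>l + 1\<close> or to the right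
    of 1.\<close>
  proof (cases "a = 1 \<and> l \<le> j \<and> j < l + 3")
    case True
    then have b2: "b = 2"
      using pv[of j] ij inn0 st(1-3) by (auto simp: allowed_orders_def)
    have "s ! 0 = 1 \<or> s ! 2 = 1" using st(3) True by (auto simp: allowed_orders_def)
    then have "p ! l = 1 \<or> p ! (l + 2) = 1" using inn0 by simp
    then have "i = l \<or> i = l + 2"
      using assms(4) ij lq nth_eq_iff_index_eq[of p i l] nth_eq_iff_index_eq[of p i "l + 2"] by auto
    then have "even l" using ij by auto
    have "t = [1, 2, c] \<or> t = [1, c, 2] \<or> t = [c, 2, 1]"
      using st(4) True b2 by (auto simp: allowed_orders_def)
    then have "(q ! l = 1 \<and> q ! (l + 1) = 2) \<or> (q ! l = 1 \<and> q ! (l + 2) = 2) \<or>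
        (q ! (l + 2) = 1 \<and> q ! (l + 1) = 2)"
      using inn0 by auto
    then show ?thesis
    proof (elim disjE conjE)
      assume "q ! l = 1" "q ! (l + 1) = 2"
      then show ?thesis unfolding parity_good_def using lq \<open>even l\<close>
        by (intro exI[of _ l] exI[of _ "l + 1"]) auto
    next
      assume "q ! l = 1" "q ! (l + 2) = 2"
      then show ?thesis unfolding parity_good_def using lq \<open>even l\<close>
        by (intro exI[of _ l] exI[of _ "l + 2"]) auto
    next
      assume "q ! (l + 2) = 1" "q ! (l + 1) = 2"
      then show ?thesis unfolding parity_good_def using lq \<open>even l\<close>
        by (intro exI[of _ "l + 2"] exI[of _ "l + 1"]) auto
    qed
  next
    case False
    from move[OF ij(1,3)] a0 obtain i' where i': "i' < length p" "q ! i' = 1" "even i' = even i"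
      "i < l \<or> l + 3 \<le> i \<longrightarrow> i' = i" "l \<le> i \<and> i < l + 3 \<longrightarrow> 1 = a \<and> l \<le> i' \<and> i' < l + 3"
      by auto
    have "\<exists>j' < length p. q ! j' = 2 \<and> even j' = even j \<and> (j < l \<or> l + 3 \<le> j \<longrightarrow> j' = j) \<and>
      (l \<le> j \<and> j < l + 3 \<longrightarrow> 2 = a \<and> l \<le> j' \<and> j' < l + 3)"
    proof (cases "a = 1")
      case True
      with False have "j < l \<or> l + 3 \<le> j" by auto
      then show ?thesis using out[of j] ij by (intro exI[of _ j]) auto
    next
      case False
      then show ?thesis using move[OF ij(2,4)] a0 by auto
    qed
    then obtain j' where j': "j' < length p" "q ! j' = 2" "even j' = even j"
      "j < l \<or> l + 3 \<le> j \<longrightarrow> j' = j" "l \<le> j \<and> j < l + 3 \<longrightarrow> 2 = a \<and> l \<le> j' \<and> j' < l + 3"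
      by blast
    \<comment> \<open>At most one of 1 and 2 lies in the triple, and it stays inside these three
      positions, so the left-to-right order of 1 and 2 is unchanged.\<close>
    have "odd j' \<or> i' < j'" using i' j' ij(6) by linarith
    then show ?thesis unfolding parity_good_def using i' j' ij lq by auto
  qed
qed

lemma parity_good_eqv:
  assumes "p \<approx> q" "parity_good p" "0 \<notin> set p" "distinct p"
  shows "parity_good q"
  using assms(1)
proof (induction rule: rtranclp_induct)
  case (step q r)
  then show ?case using parity_good_step eqv_set eqv_distinct assms by blast
qed (use assms in simp)

text \<open>If 2 and another letter follow 1, \<open>eqv_move_one_to_front\<close> applies. If only
  2 follows 1, the part before 1 is not matched and can be given a final descent, over which 1 jumps
  left. If 2 precedes 1, an even number of letters separates them, so 2 can be carried up to 1; an
  odd number of letters then stands before 2, and the last of them, \<open>c\<close>, gives a 321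
  triple \<open>c 2 1\<close>.\<close>

lemma parity_good_eqv_front:
  assumes "parity_good p" "distinct p" "0 \<notin> set p" "\<nexists>r. p = rev r @ [1, 2] \<and> matched r"
  shows "\<exists>t. p \<approx> 1 # t"
proof -
  from assms(1) obtain i j where ij: "i < length p" "j < length p" "p ! i = 1" "p ! j = 2" "even i"
    "odd j \<or> i < j" unfolding parity_good_def by blast
  define w where "w = take i p"
  define s where "s = drop (Suc i) p"
  have p: "p = w @ 1 # s" using id_take_nth_drop[OF ij(1)] ij by (simp add: w_def s_def)
  have lw: "length w = i" using ij by (simp add: w_def)
  have fin: ?thesis if e: "p \<approx> w' @ 1 # s'" and *: "even (length w')" "2 \<in> set s'" "length s' \<ge> 2" for w' s'
  proof -
    have "distinct (rev (rev w') @ 1 # s')" "0 \<notin> set (rev (rev w') @ 1 # s')"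
      using eqv_distinct[OF e] eqv_set[OF e] assms by auto
    then have "\<exists>t. rev (rev w') @ 1 # s' \<approx> 1 # t"
      by (rule eqv_move_one_to_front) (use * in auto)
    then show ?thesis using e by (metis rev_rev_ident rtranclp_trans)
  qed
  have big: "z > 2" if "z \<in> set p" "z \<noteq> 1" "z \<noteq> 2" for z
    using that assms(3) by (metis One_nat_def Suc_1 gr0I less_antisym not_less_eq)
  show ?thesis
  proof (cases "i < j")
    case True
    have "s ! (j - Suc i) = 2" "j - Suc i < length s" using True ij by (auto simp: s_def)
    then have s2: "2 \<in> set s" by (metis nth_mem)
    show ?thesis
    proof (cases "length s \<ge> 2")
      case True
      then show ?thesis using fin[of w s] p s2 lw ij by simp
    next
      case False
      with s2 have s: "s = [2]" by (cases s) (auto simp: Suc_le_eq)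
      have "\<not> matched (rev w)" using assms(4) p s by (metis append_Cons append_Nil rev_rev_ident)
      then obtain v x y where v: "y < x" "rev (rev w) \<approx> v @ [x, y]"
        using eqv_ends_in_descent[of "rev w"] lw ij assms(2) p by auto
      have e: "p \<approx> v @ [x, y, 1] @ [2]" using eqv_right[OF v(2), of "[1, 2]"] p s by simp
      have "y \<in> set p" "y \<noteq> 1" using eqv_set[OF e] eqv_distinct[OF e] assms(2) by auto
      then have "1 < y" using assms(3) by (metis less_one linorder_neqE_nat)
      then have "v @ [x, y, 1] @ [2] \<approx> v @ [1, x, y] @ [2]"
        using eqv_sym[OF eqv_min_right_132[of 1 y x v "[2]"]] v by simp
      with e have "p \<approx> v @ 1 # [x, y, 2]" by simp
      moreover have "even (length v)" using eqv_length[OF v(2)] lw ij by auto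
      ultimately show ?thesis using fin[of v "[x, y, 2]"] by simp
    qed
  next
    case False
    then have j: "odd j" "j < i" using ij by (metis, metis linorder_neqE_nat one_eq_numeral_iff)
    define u where "u = take j w"
    define v where "v = drop (Suc j) w"
    have w: "w = u @ 2 # v"
      using id_take_nth_drop[of j w] lw j ij by (simp add: w_def u_def v_def)
    have lu: "length u = j" using j lw by (simp add: u_def)
    have lv: "even (length v)" using j lw ij by (simp add: v_def)
    have "\<forall>z \<in> set v. 2 < z" using big assms(2) p w by auto
    then obtain v' where v': "2 # v \<approx> v' @ [2]"
      using eqv_move_min_right[OF lv, of 2] assms(2) p w by auto
    have "odd (length (u @ v'))" using eqv_length[OF v'] lv lu j by auto
    then obtain y c where yc: "u @ v' = y @ [c]" by (metis even_zero list.size(3) rev_exhaust)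
    have "p \<approx> (u @ v') @ [2, 1] @ s" using eqv_context[OF v', of u "1 # s"] p w by simp
    then have e: "p \<approx> y @ [c, 2, 1] @ s" using yc by simp
    have "c \<in> set p" "c \<noteq> 1" "c \<noteq> 2" using eqv_set[OF e] eqv_distinct[OF e] assms(2) by auto
    then have "2 < c" using big by blast
    then have "y @ [c, 2, 1] @ s \<approx> y @ [1, 2, c] @ s"
      using eqv_sym[OF eqv_min_right[of 1 2 c y s]] by simp
    with e have "p \<approx> y @ 1 # (2 # c # s)" by simp
    moreover have "even (length y)" using \<open>odd (length (u @ v'))\<close> yc by simp
    ultimately show ?thesis using fin[of y "2 # c # s"] by simp
  qed
qed

section \<open>Translation between adjacent moves on S_n and \<open>step\<close>\<close>

lemma has_pattern_allowed_orders:
  assumes "has_pattern a \<sigma>" "\<sigma> \<in> {[1, 2, 3], [1, 3, 2], [3, 2, 1]}"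
  obtains x y z where "x < y" "y < z" "a \<in> allowed_orders x y z"
proof -
  from assms have "length a = 3" unfolding has_pattern_def by auto
  then obtain p q r where a: "a = [p, q, r]"
    by (auto simp: length_Suc_conv numeral_3_eq_3)
  have "a ! s < a ! t \<longleftrightarrow> \<sigma> ! s < \<sigma> ! t" if "s < 3" "t < 3" for s t
    using assms(1) that by (simp add: has_pattern_def a)
  from this[of 0 1] this[of 1 2] this[of 0 2] this[of 1 0] this[of 2 1] assms(2)
  have "p < q \<and> q < r \<or> p < r \<and> r < q \<or> r < q \<and> q < p"
    by (auto simp: a)
  then show thesis using that a unfolding allowed_orders_def by blast
qed

lemma adjacent_move_imp_step:
  assumes "adjacent_move n {[1, 2, 3], [1, 3, 2], [3, 2, 1]} p q"
  shows "step p q"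
proof -
  from assms obtain u a b v \<sigma> \<sigma>' where *: "p = u @ a @ v" "q = u @ b @ v" "mset b = mset a"
    "\<sigma> \<in> {[1, 2, 3], [1, 3, 2], [3, 2, 1]}" "\<sigma>' \<in> {[1, 2, 3], [1, 3, 2], [3, 2, 1]}"
    "has_pattern a \<sigma>" "has_pattern b \<sigma>'"
    unfolding adjacent_move_def by blast
  obtain x y z where a: "x < y" "y < z" "a \<in> allowed_orders x y z"
    using has_pattern_allowed_orders[OF *(6,4)] .
  obtain x' y' z' where b: "x' < y'" "y' < z'" "b \<in> allowed_orders x' y' z'"
    using has_pattern_allowed_orders[OF *(7,5)] .
  have "mset a = mset [x, y, z]" "mset b = mset [x', y', z']"
    using a(3) b(3) by (auto simp: allowed_orders_def)
  \<comment> \<open>Both triples have the same letters, so sorting identifies the two increasing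
    triples obtained from the patterns.\<close>
  then have "sort a = [x, y, z]" "sort a = [x', y', z']"
    using a b *(3) by (auto intro!: properties_for_sort)
  then have "x' = x" "y' = y" "z' = z" by auto
  then show ?thesis unfolding step_def using *(1,2) a b by blast
qed

lemma has_pattern_of_allowed_orders:
  assumes "a \<in> allowed_orders x y z" "x < y" "y < z"
  shows "\<exists>\<sigma> \<in> {[1, 2, 3], [1, 3, 2], [3, 2, 1]}. has_pattern a \<sigma>"
proof -
  have three: "(\<forall>i < Suc (Suc (Suc 0)). P i) \<longleftrightarrow> P 0 \<and> P 1 \<and> P 2" for P
    by (auto simp: less_Suc_eq numeral_2_eq_2)
  have "has_pattern [x, y, z] [1, 2, 3]" "has_pattern [x, z, y] [1, 3, 2]"
    "has_pattern [z, y, x] [3, 2, 1]"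
    using assms by (simp_all add: has_pattern_def three)
  then show ?thesis using assms(1) unfolding allowed_orders_def by blast
qed

lemma step_imp_adjacent_move:
  assumes "step p q" "p \<in> permutations_of_set {1..n}"
  shows "adjacent_move n {[1, 2, 3], [1, 3, 2], [3, 2, 1]} p q"
proof -
  from assms(1) obtain u v a b c s t where st: "a < b" "b < c" "s \<in> allowed_orders a b c"
    "t \<in> allowed_orders a b c" "p = u @ s @ v" "q = u @ t @ v" unfolding step_def by blast
  have "length s = 3" "mset t = mset s" using st(3,4) by (auto simp: allowed_orders_def)
  then show ?thesis
    unfolding adjacent_move_def
    using assms(2) st has_pattern_of_allowed_orders[OF st(3,1,2)] has_pattern_of_allowed_orders[OF st(4,1,2)]
    by blast
qed

lemma eqv_permutations:
  assumes "p \<approx> q" "p \<in> permutations_of_set A"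
  shows "q \<in> permutations_of_set A"
  using assms eqv_set eqv_distinct unfolding permutations_of_set_def by blast

text \<open>\<open>adjacent_move\<close> demands a source in S_n. Every word reached from
  \<open>p\<close> by \<open>step\<close> is again in S_n, so each such step is an adjacent
  move.\<close>

lemma adjacent_equiv_iff_eqv:
  assumes "p \<in> permutations_of_set {1..n}"
  shows "adjacent_equiv n {[1, 2, 3], [1, 3, 2], [3, 2, 1]} p q \<longleftrightarrow> p \<approx> q"
proof
  assume "adjacent_equiv n {[1, 2, 3], [1, 3, 2], [3, 2, 1]} p q"
  then show "p \<approx> q" unfolding adjacent_equiv_def
  proof (induction rule: equivclp_induct)
    case (step q r)
    then have "q \<approx> r" using adjacent_move_imp_step eqv_sym by blast
    with step show ?case by (meson rtranclp_trans)
  qed simp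
next
  assume "p \<approx> q"
  then show "adjacent_equiv n {[1, 2, 3], [1, 3, 2], [3, 2, 1]} p q" unfolding adjacent_equiv_def
  proof (induction rule: rtranclp_induct)
    case (step q r)
    then have "q \<in> permutations_of_set {1..n}" using eqv_permutations assms by blast
    with step show ?case by (meson step_imp_adjacent_move equivclp_into_equivclp)
  qed simp
qed

section \<open>Description of the class of the identity\<close>

lemma eqv_iota_iff:
  assumes "n \<ge> 3" "p \<in> permutations_of_set {1..n}"
  shows "iota_word n \<approx> p \<longleftrightarrow> parity_good p \<and> (\<nexists>r. p = rev r @ [1, 2] \<and> matched r)"
proof -
  have p: "set p = {1..n}" "distinct p" "length p = n"
    using assms(2) length_finite_permutations_of_set[of p "{1..n}"]
    by (auto simp: permutations_of_set_def)
  have i: "iota_word n = 1 # [2..<n + 1]"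
    using assms(1) by (simp add: iota_word_def upt_conv_Cons numeral_2_eq_2)
  show ?thesis
  proof (intro iffI conjI notI)
    assume e: "iota_word n \<approx> p"
    have "parity_good (iota_word n)" unfolding parity_good_def
      using assms(1) by (intro exI[of _ 0] exI[of _ 1]) (auto simp: iota_word_def nth_append)
    then show "parity_good p" using parity_good_eqv[OF e] by (simp add: iota_word_def)
    assume "\<exists>r. p = rev r @ [1, 2] \<and> matched r"
    then obtain r where r: "p = rev r @ [1, 2]" "matched r" by blast
    have "\<forall>z \<in> set r. 1 < z"
    proof
      fix z assume "z \<in> set r"
      then have "z \<in> {1..n}" "z \<noteq> 1" using p r by auto
      then show "1 < z" by auto
    qed
    \<comment> \<open>The final letters 1 and 2 form one more pair of the reversed word, so the
      whole word admits no move and is alone in its class; the identity differs from it because it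
      ends in \<open>n\<close>, not in 2.\<close>
    then have "matched (2 # 1 # r)" using r by simp
    moreover have "rev (2 # 1 # r) \<approx> iota_word n" using eqv_sym[OF e] r by simp
    ultimately have "iota_word n = p" using matched_eqv_iff[of "2 # 1 # r" "iota_word n"] r by simp
    moreover have "last (iota_word n) = n" using assms(1) by (simp add: iota_word_def)
    moreover have "last p = 2" using r by simp
    ultimately show False using assms(1) by simp
  next
    assume a: "parity_good p \<and> (\<nexists>r. p = rev r @ [1, 2] \<and> matched r)"
    then obtain t where t: "p \<approx> 1 # t"
      using parity_good_eqv_front[of p] p assms(1) by auto
    have "set (1 # t) = {1..n}" "distinct (1 # t)"
      using eqv_set[OF t] eqv_distinct[OF t] p by auto
    then have "set t = {1..n} - {1}" "distinct t" by auto
    moreover have "{1..n} - {1} = {2..n}" by auto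
    ultimately have t': "set t = {2..n}" "distinct t" by simp_all
    then have "mset t = mset [2..<n + 1]"
      using set_eq_iff_mset_eq_distinct[of t "[2..<n + 1]"] by auto
    then have "1 # [] @ t \<approx> 1 # [] @ [2..<n + 1]"
      by (rule eqv_rearrange_right_of_min) (use t' in auto)
    then show "iota_word n \<approx> p" using t i eqv_sym by (metis append_Nil rtranclp_trans)
  qed
qed

section \<open>Counting the words that satisfy the invariant\<close>

definition ins :: "nat \<Rightarrow> nat \<Rightarrow> nat list \<Rightarrow> nat list" where
  "ins i x q = take i q @ x # drop i q"

lemma mset_ins: "mset (ins i x q) = mset (x # q)"
  unfolding ins_def by (metis append_take_drop_id mset.simps(2) mset_append union_mset_add_mset_right)

text \<open>Deleting \<open>x\<close> and recording its index inverts the insertion. Applied to 1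
  and then to 2, this turns the count into a count of index pairs.\<close>

lemma bij_betw_ins:
  assumes "finite A" "x \<in> A"
  shows "bij_betw (\<lambda>(i, q). ins i x q) ({..<card A} \<times> permutations_of_set (A - {x}))
    (permutations_of_set A)"
  unfolding bij_betw_def
proof
  have perm: "x \<notin> set q" "distinct q" "length q = card A - 1" "set q = A - {x}"
    if "q \<in> permutations_of_set (A - {x})" for q
    using that assms length_finite_permutations_of_set[of q "A - {x}"]
    by (auto simp: permutations_of_set_def)
  have c: "card A > 0" using assms card_gt_0_iff by blast
  show "inj_on (\<lambda>(i, q). ins i x q) ({..<card A} \<times> permutations_of_set (A - {x}))"
  proof (rule inj_onI, clarify)
    fix i q i' q'
    assume *: "i < card A" "q \<in> permutations_of_set (A - {x})" "i' < card A"
      "q' \<in> permutations_of_set (A - {x})" "ins i x q = ins i' x q'"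
    then have "x \<notin> set (take i q)" "x \<notin> set (drop i q)"
      using perm(1)[of q] by (auto dest: in_set_takeD in_set_dropD)
    with *(5) have e: "take i q = take i' q'" "drop i q = drop i' q'"
      unfolding ins_def by (simp_all add: append_Cons_eq_iff)
    then have "q = q'" by (metis append_take_drop_id)
    moreover have "length (take i q) = i" "length (take i' q') = i'"
      using * perm(3) c by auto
    ultimately show "i = i' \<and> q = q'" using e by metis
  qed
  show "(\<lambda>(i, q). ins i x q) ` ({..<card A} \<times> permutations_of_set (A - {x})) = permutations_of_set A"
  proof (intro equalityI subsetI)
    fix p assume "p \<in> (\<lambda>(i, q). ins i x q) ` ({..<card A} \<times> permutations_of_set (A - {x}))"
    then obtain i q where iq: "q \<in> permutations_of_set (A - {x})" "p = ins i x q" by auto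
    then have "mset p = mset (x # q)" by (simp add: mset_ins)
    then have "set p = insert x (set q)" "distinct p"
      using perm[OF iq(1)] by (metis list.simps(15) mset_eq_setD, metis distinct.simps(2) mset_eq_imp_distinct_iff)
    then show "p \<in> permutations_of_set A" using perm[OF iq(1)] assms(2) by auto
  next
    fix p assume p: "p \<in> permutations_of_set A"
    then have d: "set p = A" "distinct p" "length p = card A"
      using length_finite_permutations_of_set by (auto simp: permutations_of_set_def)
    then obtain u v where uv: "p = u @ x # v" using assms(2) by (metis split_list)
    then have "p = ins (length u) x (u @ v)" by (simp add: ins_def)
    moreover have "u @ v \<in> permutations_of_set (A - {x})" using d uv by auto
    moreover have "length u < card A" using d uv by auto
    ultimately show "p \<in> (\<lambda>(i, q). ins i x q) ` ({..<card A} \<times> permutations_of_set (A - {x}))"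
      by force
  qed
qed

lemma parity_good_ins_iff:
  assumes "r \<in> permutations_of_set {3..n}" "i < n" "j < n - 1"
  shows "parity_good (ins i 1 (ins j 2 r)) \<longleftrightarrow> even i \<and> (odd j \<or> i \<le> j)"
proof -
  define p where "p = ins i 1 (ins j 2 r)"
  have r: "set r = {3..n}" "distinct r" "length r = n - 2"
    using assms(1) length_finite_permutations_of_set[of r "{3..n}"]
    by (auto simp: permutations_of_set_def)
  have lq: "length (ins j 2 r) = n - 1" using r assms by (auto simp: ins_def)
  have lp: "length p = n" using lq assms by (auto simp: p_def ins_def[of i])
  have "mset p = mset (1 # 2 # r)" by (simp add: p_def mset_ins)
  moreover have "distinct (1 # 2 # r)" using r by simp
  ultimately have dp: "distinct p" by (metis mset_eq_imp_distinct_iff)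
  \<comment> \<open>\<open>j\<close> is the index of 2 before 1 is inserted, and \<open>j'\<close>
    is its final index: the insertion of 1 shifts 2 exactly if \<open>i \<le> j\<close>, and this is
    also when 2 ends up to the right of 1.\<close>
  define j' where "j' = (if j < i then j else j + 1)"
  have j': "j' < n" using assms by (auto simp: j'_def)
  have p1: "p ! i = 1" using assms lq by (simp add: p_def ins_def[of i] nth_append)
  have q2: "ins j 2 r ! j = 2" using assms r by (simp add: ins_def nth_append)
  have p2: "p ! j' = 2" using assms lq q2
    by (auto simp: p_def ins_def[of i] nth_append j'_def nth_Cons' Suc_diff_le)
  have "parity_good p \<longleftrightarrow> even i \<and> (odd j' \<or> i < j')"
  proof
    assume "parity_good p"
    then obtain a b where "a < n" "b < n" "p ! a = 1" "p ! b = 2" "even a" "odd b \<or> a < b"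
      unfolding parity_good_def lp by blast
    moreover from this have "a = i" "b = j'"
      using dp lp assms(2) j' p1 p2 nth_eq_iff_index_eq by metis+
    ultimately show "even i \<and> (odd j' \<or> i < j')" by simp
  qed (use p1 p2 assms(2) j' lp in \<open>auto simp: parity_good_def\<close>)
  then show ?thesis by (auto simp: p_def j'_def)
qed

text \<open>For \<open>i = 2 * a\<close> the excluded values of \<open>j\<close> are the even
  numbers below \<open>2 * a\<close>, of which there are \<open>a\<close>. The number of even
  \<open>i < n\<close> is \<open>(n + 1) div 2\<close>.\<close>

lemma card_parity_good_positions:
  "card {(i, j). i < n \<and> j < n - 1 \<and> even i \<and> (odd j \<or> i \<le> j)}
    = (\<Sum>a < (n + 1) div 2. n - 1 - a)"
proof -
  have "{(i, j). i < n \<and> j < n - 1 \<and> even i \<and> (odd j \<or> i \<le> j)}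
      = Sigma {i. i < n \<and> even i} (\<lambda>i. {j. j < n - 1 \<and> (odd j \<or> i \<le> j)})" by auto
  then have "card {(i, j). i < n \<and> j < n - 1 \<and> even i \<and> (odd j \<or> i \<le> j)}
      = (\<Sum>i \<in> {i. i < n \<and> even i}. card {j. j < n - 1 \<and> (odd j \<or> i \<le> j)})" by simp
  also have "{i. i < n \<and> even i} = (\<lambda>a. 2 * a) ` {..<(n + 1) div 2}"
    by (auto elim!: evenE)
  also have "(\<Sum>i \<in> (\<lambda>a. 2 * a) ` {..<(n + 1) div 2}. card {j. j < n - 1 \<and> (odd j \<or> i \<le> j)})
      = (\<Sum>a < (n + 1) div 2. card {j. j < n - 1 \<and> (odd j \<or> 2 * a \<le> j)})"
    by (subst sum.reindex) (auto simp: inj_on_def)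
  also have "\<dots> = (\<Sum>a < (n + 1) div 2. n - 1 - a)"
  proof (rule sum.cong)
    fix a assume "a \<in> {..<(n + 1) div 2}"
    then have a: "2 * a \<le> n - 1" by auto
    have "{j. j < n - 1 \<and> (odd j \<or> 2 * a \<le> j)} = {..<n - 1} - (\<lambda>b. 2 * b) ` {..<a}"
      using a by (auto elim!: evenE)
    moreover have "(\<lambda>b. 2 * b) ` {..<a} \<subseteq> {..<n - 1}" using a by auto
    moreover have "card ((\<lambda>b. 2 * b) ` {..<a}) = a" by (subst card_image) (auto simp: inj_on_def)
    ultimately show "card {j. j < n - 1 \<and> (odd j \<or> 2 * a \<le> j)} = n - 1 - a"
      by (simp add: card_Diff_subset)
  qed simp
  finally show ?thesis .
qed

text \<open>Inserting 2 and then 1 parametrises S_n by an index pair and the order \<open>r\<close>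
  of the remaining letters. The invariant depends on the index pair only, which gives a
  product.\<close>

lemma card_parity_good:
  assumes "n \<ge> 2"
  shows "card {p \<in> permutations_of_set {1..n}. parity_good p} = (\<Sum>a < (n + 1) div 2. n - 1 - a) * fact (n - 2)"
proof -
  let ?R = "permutations_of_set {3..n}"
  let ?f = "\<lambda>((i, j), r). ins i 1 (ins j 2 r)"
  let ?D = "({..<n} \<times> {..<n - 1}) \<times> ?R"
  let ?P = "{(i, j). i < n \<and> j < n - 1 \<and> even i \<and> (odd j \<or> i \<le> j)}"
  have s1: "{1..n} - {1} = {2..n}" and s2: "{2..n} - {2} = {3..n}" by auto
  have b1: "bij_betw (\<lambda>(i, q). ins i 1 q) ({..<n} \<times> permutations_of_set {2..n}) (permutations_of_set {1..n})"
    using bij_betw_ins[of "{1..n}" 1] assms s1 by simp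
  have b2: "bij_betw (\<lambda>(j, r). ins j 2 r) ({..<n - 1} \<times> ?R) (permutations_of_set {2..n})"
    using bij_betw_ins[of "{2..n}" 2] assms s2 by simp
  have inj: "inj_on ?f ?D"
  proof (rule inj_onI)
    fix d d' assume dd: "d \<in> ?D" "d' \<in> ?D" "?f d = ?f d'"
    obtain i j r i' j' r' where d: "d = ((i, j), r)" "d' = ((i', j'), r')" by (metis surj_pair)
    with dd have *: "i < n" "j < n - 1" "r \<in> ?R" "i' < n" "j' < n - 1" "r' \<in> ?R"
      "ins i 1 (ins j 2 r) = ins i' 1 (ins j' 2 r')" by auto
    have "ins j 2 r \<in> permutations_of_set {2..n}" "ins j' 2 r' \<in> permutations_of_set {2..n}"
      using * b2 by (auto simp: bij_betw_def)
    then have "(i, ins j 2 r) = (i', ins j' 2 r')"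
      using * inj_onD[OF bij_betw_imp_inj_on[OF b1], of "(i, ins j 2 r)" "(i', ins j' 2 r')"] by auto
    then show "d = d'"
      using d * inj_onD[OF bij_betw_imp_inj_on[OF b2], of "(j, r)" "(j', r')"] by auto
  qed
  have im: "?f ` ?D = permutations_of_set {1..n}"
  proof -
    have "?f ` ?D = (\<lambda>(i, q). ins i 1 q) ` ({..<n} \<times> ((\<lambda>(j, r). ins j 2 r) ` ({..<n - 1} \<times> ?R)))"
      by force
    then show ?thesis using b1 b2 by (simp add: bij_betw_def)
  qed
  have "{p \<in> permutations_of_set {1..n}. parity_good p} = ?f ` {d \<in> ?D. parity_good (?f d)}"
    unfolding im[symmetric] by blast
  also have "{d \<in> ?D. parity_good (?f d)} = ?P \<times> ?R"
    using parity_good_ins_iff by auto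
  finally have "{p \<in> permutations_of_set {1..n}. parity_good p} = ?f ` (?P \<times> ?R)" .
  moreover have "card (?f ` (?P \<times> ?R)) = card (?P \<times> ?R)"
    by (rule card_image[OF inj_on_subset[OF inj]]) auto
  ultimately have "card {p \<in> permutations_of_set {1..n}. parity_good p} = card ?P * card ?R"
    by (simp only: card_cartesian_product)
  moreover have "card ?R = fact (n - 2)" using assms by (simp add: numeral_3_eq_3 numeral_2_eq_2)
  ultimately show ?thesis using card_parity_good_positions[of n] by simp
qed

section \<open>Counting the matched words\<close>

lemma odd_double_fact_rec:
  assumes "odd m"
  shows "odd_double_fact (m + 2) = (m + 2) * odd_double_fact m"
proof -
  have "{i \<in> {1..m + 2}. odd i} = insert (m + 2) {i \<in> {1..m}. odd i}"
    using assms by (auto simp: le_Suc_eq)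
  then show ?thesis unfolding odd_double_fact_def by simp
qed

text \<open>The minimum of \<open>A\<close> has to be the smaller entry of the first pair. Its
  partner can be any of the other \<open>2 * m + 1\<close> letters when \<open>A\<close> has
  \<open>2 * m + 2\<close>, and the rest is a matched word on the remaining letters.\<close>

lemma card_matched:
  assumes "finite A" "card A = 2 * m"
  shows "card {r \<in> permutations_of_set A. matched r} = odd_double_fact (2 * m - 1)"
  using assms
proof (induction m arbitrary: A)
  case 0
  then have "{r \<in> permutations_of_set A. matched r} = {[]}" by auto
  then show ?case by (simp add: odd_double_fact_def)
next
  case (Suc m)
  define x where "x = Min A"
  have "A \<noteq> {}" using Suc.prems by auto
  then have "x \<in> A" "\<forall>z \<in> A. x \<le> z"
    using Suc.prems(1) by (auto simp: x_def)
  then have x: "x \<in> A" "z \<in> A \<Longrightarrow> z \<noteq> x \<Longrightarrow> x < z" for z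
    by (auto simp: order_less_le)
  let ?S = "Sigma (A - {x}) (\<lambda>y. {r \<in> permutations_of_set (A - {x, y}). matched r})"
  have "{r \<in> permutations_of_set A. matched r} = (\<lambda>(y, r). y # x # r) ` ?S" (is "?L = ?R")
  proof (intro equalityI subsetI)
    fix p assume "p \<in> ?L"
    then have p: "set p = A" "distinct p" "matched p" by (auto simp: permutations_of_set_def)
    with \<open>A \<noteq> {}\<close> obtain y x' r where pr: "p = y # x' # r" by (cases p rule: matched.cases) auto
    have "x' = x"
    proof (rule ccontr)
      assume "x' \<noteq> x"
      then have "x < x'" "x = y \<or> x \<in> set r" using x p pr by auto
      then show False using p pr by auto
    qed
    then show "p \<in> ?R" using p pr by (auto simp: permutations_of_set_def)
  next
    fix p assume "p \<in> ?R"
    then obtain y r where yr: "y \<in> A" "y \<noteq> x" "set r = A - {x, y}" "distinct r" "matched r"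
      "p = y # x # r" by (auto simp: permutations_of_set_def)
    have "\<forall>z \<in> set r. x < z" "x < y" using x(2) yr by simp_all
    moreover have "set p = A" using x(1) yr by auto
    ultimately show "p \<in> ?L" using yr by (simp add: permutations_of_set_def)
  qed
  moreover have "card ((\<lambda>(y, r). y # x # r) ` ?S) = card ?S"
    by (rule card_image) (auto simp: inj_on_def)
  moreover have "card ?S = (\<Sum>y \<in> A - {x}. odd_double_fact (2 * m - 1))"
  proof (subst card_SigmaI)
    show "(\<Sum>y \<in> A - {x}. card {r \<in> permutations_of_set (A - {x, y}). matched r})
        = (\<Sum>y \<in> A - {x}. odd_double_fact (2 * m - 1))"
    proof (rule sum.cong)
      fix y assume "y \<in> A - {x}"
      then have "card (A - {x, y}) = 2 * m" using Suc.prems x by (subst card_Diff_subset) auto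
      then show "card {r \<in> permutations_of_set (A - {x, y}). matched r} = odd_double_fact (2 * m - 1)"
        using Suc.IH Suc.prems by simp
    qed simp
  qed (use Suc.prems in auto)
  ultimately have "card {r \<in> permutations_of_set A. matched r} = (2 * m + 1) * odd_double_fact (2 * m - 1)"
    using Suc.prems x by simp
  also have "\<dots> = odd_double_fact (2 * Suc m - 1)"
  proof (cases m)
    case 0
    \<comment> \<open>For \<open>m = 0\<close> the subtraction in \<open>2 * m - 1\<close> is
      truncated to 0, which is even, so the recursion cannot be used and the two values are compared
      directly.\<close>
    have "{i \<in> {1..1}. odd i} = {1::nat}" by auto
    then show ?thesis using 0 by (simp add: odd_double_fact_def)
  next
    case (Suc l)
    then show ?thesis using odd_double_fact_rec[of "2 * m - 1"] by simp
  qed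
  finally show ?case .
qed

section \<open>The size of the class of the identity\<close>

text \<open>The exceptions form a subset of the words satisfying the invariant, as a matched
  \<open>r\<close> has even length and so 1 is at an even index with 2 behind it. They correspond to
  the matched words on the \<open>n - 2\<close> letters of \<open>{3..n}\<close>. The equation is
  additive to avoid subtraction of natural numbers.\<close>

lemma card_eqv_iota:
  assumes "n \<ge> 3"
  shows "card {p \<in> permutations_of_set {1..n}. iota_word n \<approx> p} + (if even n then odd_double_fact (n - 3) else 0)
    = (\<Sum>a < (n + 1) div 2. n - 1 - a) * fact (n - 2)"
proof -
  let ?G = "{p \<in> permutations_of_set {1..n}. parity_good p}"
  let ?M = "{r \<in> permutations_of_set {3..n}. matched r}"
  let ?E = "(\<lambda>r. rev r @ [1, 2]) ` ?M"
  let ?C = "{p \<in> permutations_of_set {1..n}. iota_word n \<approx> p}"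
  have cM: "card ?M = (if even n then odd_double_fact (n - 3) else 0)"
  proof (cases "even n")
    case True
    then obtain k where k: "n = 2 * k" by blast
    have "card ?M = odd_double_fact (2 * (k - 1) - 1)" by (rule card_matched) (use k in auto)
    moreover have "2 * (k - 1) - 1 = n - 3" using k by simp
    ultimately show ?thesis using True by (simp only: if_True)
  next
    case False
    have "\<not> matched r" if "r \<in> permutations_of_set {3..n}" for r
      using matched_even[of r] length_finite_permutations_of_set[OF that] False assms by auto
    then have "?M = {}" by blast
    then show ?thesis using False by simp
  qed
  have cE: "card ?E = card ?M" by (rule card_image) (auto simp: inj_on_def)
  have E_iff: "p \<in> ?E \<longleftrightarrow> p \<in> permutations_of_set {1..n} \<and> (\<exists>r. p = rev r @ [1, 2] \<and> matched r)" for p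
  proof
    assume "p \<in> ?E"
    then show "p \<in> permutations_of_set {1..n} \<and> (\<exists>r. p = rev r @ [1, 2] \<and> matched r)"
      using assms by (auto simp: permutations_of_set_def)
  next
    assume a: "p \<in> permutations_of_set {1..n} \<and> (\<exists>r. p = rev r @ [1, 2] \<and> matched r)"
    then obtain r where r: "p = rev r @ [1, 2]" "matched r" by blast
    with a have "insert 1 (insert 2 (set r)) = {1..n}" "distinct r" "1 \<notin> set r" "2 \<notin> set r"
      by (auto simp: permutations_of_set_def)
    then have "set r = {1..n} - {1, 2}" "distinct r" by auto
    moreover have "{1..n} - {1, 2} = {3..n}" by auto
    ultimately show "p \<in> ?E" using r by (auto simp: permutations_of_set_def)
  qed
  have "?E \<subseteq> ?G"
  proof
    fix p assume "p \<in> ?E"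
    then obtain r where r: "p = rev r @ [1, 2]" "matched r" "p \<in> permutations_of_set {1..n}"
      using E_iff by blast
    have "parity_good p" unfolding parity_good_def
      using r(1) matched_even[OF r(2)]
      by (intro exI[of _ "length r"] exI[of _ "length r + 1"]) (simp add: nth_append)
    then show "p \<in> ?G" using r by blast
  qed
  moreover have "?C = ?G - ?E" using eqv_iota_iff[OF assms] E_iff by blast
  ultimately have "card ?C = card ?G - card ?E" "card ?E \<le> card ?G"
    by (auto intro!: card_Diff_subset card_mono)
  then have "card ?C + card ?E = card ?G" by linarith
  then show ?thesis using cE cM card_parity_good[of n] assms by simp
qed

text \<open>The bound \<open>m \<le> n\<close> makes each difference \<open>n - 1 - a\<close> exact,
  so the sum can be evaluated over the reals.\<close>

lemma sum_descending:
  "m \<le> n \<Longrightarrow> real (\<Sum>a < m. n - 1 - a) = real m * (real n - 1) - real m * (real m - 1) / 2"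
  by (induction m) (auto simp: field_simps of_nat_diff)

theorem theorem3p2:
  fixes n :: nat
  assumes "n \<ge> 3"
  defines "N \<equiv> card {p \<in> permutations_of_set {1..n}.
             adjacent_equiv n {[1,2,3], [1,3,2], [3,2,1]} (iota_word n) p}"
  shows "(\<forall>k. n = 2 * k + 1 \<longrightarrow>
            real N = 3 / 2 * real k * (real k + 1) * fact (2 * k - 1)) \<and>
         (\<forall>k. n = 2 * k \<longrightarrow>
            real N = 3 / 2 * real k * (real k - 1 / 3) * fact (2 * k - 2)
                       - real (odd_double_fact (2 * k - 3)))"
proof -
  have "iota_word n \<in> permutations_of_set {1..n}"
    by (auto simp: iota_word_def permutations_of_set_def)
  then have "N = card {p \<in> permutations_of_set {1..n}. iota_word n \<approx> p}"
    unfolding N_def by (simp only: adjacent_equiv_iff_eqv)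
  then have "N + (if even n then odd_double_fact (n - 3) else 0)
      = (\<Sum>a < (n + 1) div 2. n - 1 - a) * fact (n - 2)"
    using card_eqv_iota[OF assms(1)] by simp
  then have "real N + real (if even n then odd_double_fact (n - 3) else 0)
      = real (\<Sum>a < (n + 1) div 2. n - 1 - a) * fact (n - 2)"
    by (metis of_nat_add of_nat_fact of_nat_mult)
  then have N: "real N + real (if even n then odd_double_fact (n - 3) else 0)
      = (real ((n + 1) div 2) * (real n - 1) - real ((n + 1) div 2) * (real ((n + 1) div 2) - 1) / 2)
        * fact (n - 2)"
    by (subst (asm) sum_descending) (use assms in auto)
  show ?thesis
  proof (intro conjI allI impI)
    fix k assume k: "n = 2 * k + 1"
    \<comment> \<open>The factor becomes \<open>2 * k * (k + 1) - k * (k + 1) / 2\<close>, that is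
      \<open>3 / 2 * k * (k + 1)\<close>.\<close>
    have "(n + 1) div 2 = k + 1" "n - 2 = 2 * k - 1" "odd n" using k by auto
    then show "real N = 3 / 2 * real k * (real k + 1) * fact (2 * k - 1)"
      using N k by (simp add: field_simps)
  next
    fix k assume k: "n = 2 * k"
    \<comment> \<open>The factor becomes \<open>k * (2 * k - 1) - k * (k - 1) / 2\<close>, that is
      \<open>3 / 2 * k * (k - 1 / 3)\<close>.\<close>
    have "(n + 1) div 2 = k" "n - 2 = 2 * k - 2" "even n" using k by auto
    then show "real N = 3 / 2 * real k * (real k - 1 / 3) * fact (2 * k - 2)
                       - real (odd_double_fact (2 * k - 3))"
      using N k by (simp add: field_simps)
  qed
qed

end
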